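(* Let $a,b,c\in\mathbb{R}$ with $a\neq0$, let $g:\mathbb{R}\to\mathbb{R}$, $g(x)=ax^2+bx+c$, and let $\delta:=b^2-4ac-2b-7$. Let $(x,y,z)$ be an ordered triple of pairwise distinct real numbers, and set $p:=y-x$, $r:=\frac{z-y}{y-x}$ (so $p\ne0$ and $r\notin\{0,-1\}$). The following statements are equivalent: (i) $(x,y,z)$ is a representative of a 3-cycle of the map $x_{t+1}=g(x_t)$, i.e. $g(x)=y$, $g(y)=z$, $g(z)=x$. (ii) $p$, $x$ and $r$ satisfy $$p=-\frac{r^2+r+1}{a\,r(r+1)},\qquad x=-\frac{b}{2a}+\frac{r^3+2r^2+r+1}{2a\,r(r+1)},$$ and $r$ is a root of the polynomial $$P_\delta(X)=X^6+2X^5-(\delta+3)X^4-2(\delta+3)X^3+(2-\delta)X^2+4X+1.$$ *)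

theory Defs
  imports Complex_Main "HOL-Computational_Algebra.Polynomial"
begin

definition quad_map :: "real \<Rightarrow> real \<Rightarrow> real \<Rightarrow> real \<Rightarrow> real" where
  "quad_map a b c x = a * x^2 + b * x + c"

(* (x, y, z) lists one period of a 3-cycle of the map f, in orbit order; distinctness
   rules out fixed points. *)
definition three_cycle_rep :: "('a \<Rightarrow> 'a) \<Rightarrow> 'a \<Rightarrow> 'a \<Rightarrow> 'a \<Rightarrow> bool" where
  "three_cycle_rep f x y z \<longleftrightarrow> distinct [x, y, z] \<and> f x = y \<and> f y = z \<and> f z = x"

definition quad_delta :: "real \<Rightarrow> real \<Rightarrow> real \<Rightarrow> real" where
  "quad_delta a b c = b^2 - 4 * a * c - 2 * b - 7"

(* X^6 + 2 X^5 - (d+3) X^4 - 2(d+3) X^3 + (2-d) X^2 + 4 X + 1, constant term first *)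
definition P_poly :: "real \<Rightarrow> real poly" where
  "P_poly d = [:1, 4, 2 - d, - (2 * (d + 3)), - (d + 3), 2, 1:]"

(* Hence r and r + 1 are nonzero for r = (z - y) / (y - x), so division by r (r + 1) is genuine. *)
lemma increment_ratio_nondegenerate:
  fixes x y z :: real
  assumes "distinct [x, y, z]"
  shows "y - x \<noteq> 0" and "(z - y) / (y - x) \<notin> {0, -1}"
  using assms by (auto simp: divide_eq_eq)

end

theory Submission imports Defs begin

text \<open>With \<open>y = x + p\<close>, \<open>z = x + p + r p\<close> and \<open>u = 2 a x + b\<close>, differences of the three
  cycle equations are divisible by \<open>p\<close> and become \<open>u + a p = r\<close> and
  \<open>r (u + 2 a p + r a p) = -(r + 1)\<close>, which determine \<open>a p\<close> and \<open>u\<close> as rational functions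
  of \<open>r\<close>. Completing the square turns the remaining equation \<open>g x = y\<close> into
  \<open>u\<^sup>2 - 2 u - 4 a p = \<delta> + 7\<close>; multiplying by \<open>(r (r + 1))\<^sup>2\<close> gives \<open>P\<^sub>\<delta>(r) = 0\<close>.\<close>

lemma quad_map_step_iff:
  fixes a b c x p :: real
  assumes "a \<noteq> 0"
  shows "quad_map a b c x = x + p \<longleftrightarrow>
    (2 * a * x + b)^2 - 2 * (2 * a * x + b) - 4 * (a * p) = quad_delta a b c + 7"
proof -
  have "(2 * a * x + b)^2 - 2 * (2 * a * x + b) - 4 * (a * p) - (quad_delta a b c + 7)
      = 4 * a * (quad_map a b c x - (x + p))"
    unfolding quad_map_def quad_delta_def by algebra
  then show ?thesis
    using assms by (smt (verit) mult_eq_0_iff)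
qed

lemma quad_map_diff:
  "quad_map a b c (x + h) - quad_map a b c x = h * (2 * a * x + b + a * h)"
  unfolding quad_map_def by algebra

lemma cycle_increments_iff:
  fixes q r u :: real
  assumes "r * (r + 1) \<noteq> 0"
  shows "u + q = r \<and> r * (u + 2 * q + r * q) = - (r + 1) \<longleftrightarrow>
    q * (r * (r + 1)) = - (r^2 + r + 1) \<and> u * (r * (r + 1)) = r^3 + 2 * r^2 + r + 1"
    (is "?L \<longleftrightarrow> ?R")
proof
  assume ?L
  then have u: "u = r - q" and "r * (u + 2 * q + r * q) = - (r + 1)"
    by auto
  then have q: "q * (r * (r + 1)) = - (r^2 + r + 1)"
    by algebra
  with u have "u * (r * (r + 1)) = r^3 + 2 * r^2 + r + 1"
    by algebra
  with q show ?R ..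
next
  assume ?R
  then have q: "q * (r * (r + 1)) = - (r^2 + r + 1)"
    and u: "u * (r * (r + 1)) = r^3 + 2 * r^2 + r + 1"
    by auto
  then have "(u + q - r) * (r * (r + 1)) = 0"
    by algebra
  then have sum: "u + q = r"
    using assms by simp
  with q have "r * (u + 2 * q + r * q) = - (r + 1)"
    by algebra
  with sum show ?L ..
qed

lemma poly_P_poly:
  assumes "u * (r * (r + 1)) = r^3 + 2 * r^2 + r + 1"
    and "q * (r * (r + 1)) = - (r^2 + r + 1)"
  shows "poly (P_poly d) r = (r * (r + 1))^2 * (u^2 - 2 * u - 4 * q - (d + 7))"
proof -
  have "(r * (r + 1))^2 * (u^2 - 2 * u - 4 * q - (d + 7))
      = (u * (r * (r + 1)))^2 - 2 * (u * (r * (r + 1))) * (r * (r + 1))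
        - 4 * (q * (r * (r + 1))) * (r * (r + 1)) - (d + 7) * (r * (r + 1))^2"
    by algebra
  also have "\<dots> = poly (P_poly d) r"
    unfolding assms P_poly_def by simp algebra
  finally show ?thesis by simp
qed

theorem lemma2p2:
  fixes a b c x y z p r :: real
  assumes "a \<noteq> 0"
    and "distinct [x, y, z]"
    and "p = y - x"
    and "r = (z - y) / (y - x)"
  shows "three_cycle_rep (quad_map a b c) x y z \<longleftrightarrow>
    p = - ((r^2 + r + 1) / (a * r * (r + 1))) \<and>
    x = - (b / (2 * a)) + (r^3 + 2 * r^2 + r + 1) / (2 * a * r * (r + 1)) \<and>
    poly (P_poly (quad_delta a b c)) r = 0"
proof -
  define u where "u = 2 * a * x + b"
  define q where "q = a * p"
  have p: "p \<noteq> 0" and r: "r \<noteq> 0" "r + 1 \<noteq> 0"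
    using increment_ratio_nondegenerate[OF assms(2)] assms(3,4) by auto
  then have s: "r * (r + 1) \<noteq> 0" by simp
  have y: "y = x + p" and z: "z = y + r * p"
    using p assms(3,4) by auto
  have "quad_map a b c y - quad_map a b c x = p * (u + q)"
    unfolding y quad_map_diff u_def q_def by simp
  moreover have "quad_map a b c z - quad_map a b c y = p * (r * (u + 2 * q + r * q))"
    unfolding z quad_map_diff unfolding y u_def q_def by algebra
  moreover have "z - y = p * r" "x - z = p * (- (r + 1))"
    unfolding z y by algebra+
  ultimately have "quad_map a b c x = y \<and> quad_map a b c y = z \<and> quad_map a b c z = x \<longleftrightarrow>
      quad_map a b c x = y \<and> p * (u + q) = p * r \<and>
      p * (r * (u + 2 * q + r * q)) = p * (- (r + 1))"
    by (smt (verit))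
  then have "three_cycle_rep (quad_map a b c) x y z \<longleftrightarrow>
      quad_map a b c x = x + p \<and> u + q = r \<and> r * (u + 2 * q + r * q) = - (r + 1)"
    using assms(2) p by (simp only: three_cycle_rep_def mult_cancel_left y) simp
  also have "\<dots> \<longleftrightarrow> q * (r * (r + 1)) = - (r^2 + r + 1) \<and>
      u * (r * (r + 1)) = r^3 + 2 * r^2 + r + 1 \<and>
      u^2 - 2 * u - 4 * q = quad_delta a b c + 7"
    using cycle_increments_iff[OF s] quad_map_step_iff[OF assms(1)]
    unfolding u_def q_def by blast
  also have "\<dots> \<longleftrightarrow> q * (r * (r + 1)) = - (r^2 + r + 1) \<and>
      u * (r * (r + 1)) = r^3 + 2 * r^2 + r + 1 \<and> poly (P_poly (quad_delta a b c)) r = 0"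
    using poly_P_poly[of u r q "quad_delta a b c"] s by auto
  also have "q * (r * (r + 1)) = - (r^2 + r + 1) \<longleftrightarrow>
      p = - ((r^2 + r + 1) / (a * r * (r + 1)))"
  proof -
    have "a * r * (r + 1) \<noteq> 0" using assms(1) r by simp
    then show ?thesis
      unfolding q_def minus_divide_left by (simp only: eq_divide_eq) (simp add: mult_ac)
  qed
  also have "u * (r * (r + 1)) = r^3 + 2 * r^2 + r + 1 \<longleftrightarrow>
      x = - (b / (2 * a)) + (r^3 + 2 * r^2 + r + 1) / (2 * a * r * (r + 1))"
  proof -
    have "2 * a * r * (r + 1) \<noteq> 0" using assms(1) r by simp
    moreover have "x + b / (2 * a) = u / (2 * a)"
      unfolding u_def using assms(1) by (simp add: field_simps)
    then have "(x + b / (2 * a)) * (2 * a * r * (r + 1)) = u * (r * (r + 1))"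
      using assms(1) by simp
    ultimately have "u * (r * (r + 1)) = r^3 + 2 * r^2 + r + 1 \<longleftrightarrow>
        x + b / (2 * a) = (r^3 + 2 * r^2 + r + 1) / (2 * a * r * (r + 1))"
      by (simp only: eq_divide_eq) simp
    then show ?thesis by argo
  qed
  finally show ?thesis .
qed

end
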